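(* A graph $G$ is perfectly well-ve-dominated, or equivalently perfectly well-isolated, if and only if $G$ is $(P_4,\,K_1\vee 2K_2,\,\overline{P_3\cup P_3})$-free. Furthermore, every nontrivial connected graph $G$ satisfying these equivalent conditions has $\gamma_{\mathrm{ve}}(G)=\iota(G)=1$.
   Context: All graphs are finite, simple and undirected. For a vertex $v$ of $G$, $N_G[v]$ is its closed neighborhood, and $N_G[D]=\bigcup_{v\in D}N_G[v]$. A vertex $v$ ve-dominates an edge $e$ if at least one endpoint of $e$ belongs to $N_G[v]$. A set $D\subseteq V(G)$ is a ve-dominating set if every edge of $G$ is ve-dominated by some vertex of $D$; it is minimal if no proper subset is ve-dominating. $\gamma_{\mathrm{ve}}(G)$ is the minimum cardinality of a ve-dominating set. $G$ is well-ve-dominated if all its minimal ve-dominating sets have the same cardinality. A set $D\subseteq V(G)$ is an isolating set if $G-N_G[D]$ has no edges; $\iota(G)$ is the minimum cardinality of an isolating set, and $G$ is well-isolated if all its (inclusion-)minimal isolating sets have the same cardinality. $G$ is perfectly well-ve-dominated (respectively perfectly well-isolated) if every induced subgraph of $G$ is well-ve-dominated (respectively well-isolated). A graph is $(H_1,\dots,H_k)$-free if it has no induced subgraph isomorphic to any $H_i$. $P_n$ and $K_n$ are the path and the complete graph on $n$ vertices, $\cup$ denotes disjoint union, $2K_2$ is the disjoint union of two copies of $K_2$, $\overline{G}$ is the complement of $G$, and $G\vee H$ is the join (the disjoint union of $G$ and $H$ together with all edges between $V(G)$ and $V(H)$). A nontrivial graph is one with at least two vertices. *)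

theory Defs
  imports "Graph_Theory.Graph_Theory"
begin

text \<open>
  A finite simple undirected graph is a \<open>pre_digraph\<close> satisfying the locale predicate
  \<^term>\<open>graph\<close>: finite, loop-free, without parallel arcs, and symmetric. An undirected
  edge is thus represented by its two opposite arcs; all notions below only ask which
  vertices are the ends of an arc, so they do not depend on the orientation.
\<close>

definition closed_nbhd :: "('a, 'b) pre_digraph \<Rightarrow> 'a \<Rightarrow> 'a set" where
  "closed_nbhd G v = {v} \<union> {u. v \<rightarrow>\<^bsub>G\<^esub> u}"

definition closed_nbhd_set :: "('a, 'b) pre_digraph \<Rightarrow> 'a set \<Rightarrow> 'a set" where
  "closed_nbhd_set G D = (\<Union>v\<in>D. closed_nbhd G v)"

definition ve_dominates :: "('a, 'b) pre_digraph \<Rightarrow> 'a \<Rightarrow> 'b \<Rightarrow> bool" where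
  "ve_dominates G v e \<longleftrightarrow> tail G e \<in> closed_nbhd G v \<or> head G e \<in> closed_nbhd G v"

definition ve_dominating :: "('a, 'b) pre_digraph \<Rightarrow> 'a set \<Rightarrow> bool" where
  "ve_dominating G D \<longleftrightarrow> D \<subseteq> verts G \<and> (\<forall>e\<in>arcs G. \<exists>v\<in>D. ve_dominates G v e)"

definition isolating :: "('a, 'b) pre_digraph \<Rightarrow> 'a set \<Rightarrow> bool" where
  "isolating G D \<longleftrightarrow> D \<subseteq> verts G \<and> arcs (G \<restriction> (verts G - closed_nbhd_set G D)) = {}"

definition minimal_set :: "('a set \<Rightarrow> bool) \<Rightarrow> 'a set \<Rightarrow> bool" where
  "minimal_set P D \<longleftrightarrow> P D \<and> (\<forall>D'. D' \<subset> D \<longrightarrow> \<not> P D')"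

definition ve_domination_number :: "('a, 'b) pre_digraph \<Rightarrow> nat" (\<open>\<gamma>\<^sub>v\<^sub>e\<close>) where
  "\<gamma>\<^sub>v\<^sub>e G = Min (card ` {D. ve_dominating G D})"

definition isolation_number :: "('a, 'b) pre_digraph \<Rightarrow> nat" (\<open>\<iota>\<close>) where
  "\<iota> G = Min (card ` {D. isolating G D})"

definition well_ve_dominated :: "('a, 'b) pre_digraph \<Rightarrow> bool" where
  "well_ve_dominated G \<longleftrightarrow>
    (\<forall>D D'. minimal_set (ve_dominating G) D \<and> minimal_set (ve_dominating G) D'
      \<longrightarrow> card D = card D')"

definition well_isolated :: "('a, 'b) pre_digraph \<Rightarrow> bool" where
  "well_isolated G \<longleftrightarrow>
    (\<forall>D D'. minimal_set (isolating G) D \<and> minimal_set (isolating G) D'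
      \<longrightarrow> card D = card D')"

definition perfectly_well_ve_dominated :: "('a, 'b) pre_digraph \<Rightarrow> bool" where
  "perfectly_well_ve_dominated G \<longleftrightarrow> (\<forall>H. induced_subgraph H G \<longrightarrow> well_ve_dominated H)"

definition perfectly_well_isolated :: "('a, 'b) pre_digraph \<Rightarrow> bool" where
  "perfectly_well_isolated G \<longleftrightarrow> (\<forall>H. induced_subgraph H G \<longrightarrow> well_isolated H)"

definition induced_free :: "('c, 'd) pre_digraph \<Rightarrow> ('a, 'b) pre_digraph \<Rightarrow> bool" where
  "induced_free F G \<longleftrightarrow> \<not> (\<exists>H. induced_subgraph H G \<and> digraph_iso H F)"

definition path_graph :: "nat \<Rightarrow> nat pair_pre_digraph" where
  "path_graph n =
    \<lparr>pverts = {..<n}, parcs = {(i, j). i < n \<and> j < n \<and> (j = Suc i \<or> i = Suc j)}\<rparr>"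

definition complete_graph :: "nat \<Rightarrow> nat pair_pre_digraph" where
  "complete_graph n = \<lparr>pverts = {..<n}, parcs = {(i, j). i < n \<and> j < n \<and> i \<noteq> j}\<rparr>"

definition complement_graph :: "'a pair_pre_digraph \<Rightarrow> 'a pair_pre_digraph" where
  "complement_graph G =
    \<lparr>pverts = pverts G,
     parcs = {(u, v). u \<in> pverts G \<and> v \<in> pverts G \<and> u \<noteq> v \<and> (u, v) \<notin> parcs G}\<rparr>"

definition disjoint_union_graph ::
    "'a pair_pre_digraph \<Rightarrow> 'b pair_pre_digraph \<Rightarrow> ('a + 'b) pair_pre_digraph" where
  "disjoint_union_graph G H =
    \<lparr>pverts = pverts G <+> pverts H,
     parcs = map_prod Inl Inl ` parcs G \<union> map_prod Inr Inr ` parcs H\<rparr>"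

definition join_graph ::
    "'a pair_pre_digraph \<Rightarrow> 'b pair_pre_digraph \<Rightarrow> ('a + 'b) pair_pre_digraph" where
  "join_graph G H =
    \<lparr>pverts = pverts (disjoint_union_graph G H),
     parcs = parcs (disjoint_union_graph G H)
       \<union> (Inl ` pverts G) \<times> (Inr ` pverts H) \<union> (Inr ` pverts H) \<times> (Inl ` pverts G)\<rparr>"

lemma complete_digraph_complete_graph: "complete_digraph n (with_proj (complete_graph n))"
  by (auto simp: complete_digraph_pair_def complete_graph_def)

lemma pair_graph_iff:
  "pair_graph G \<longleftrightarrow> finite (pverts G) \<and> parcs G \<subseteq> pverts G \<times> pverts G
     \<and> (\<forall>u v. (u, v) \<in> parcs G \<longrightarrow> u \<noteq> v \<and> (v, u) \<in> parcs G)"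
proof
  assume "pair_graph G"
  then interpret pair_graph G .
  show "finite (pverts G) \<and> parcs G \<subseteq> pverts G \<times> pverts G
     \<and> (\<forall>u v. (u, v) \<in> parcs G \<longrightarrow> u \<noteq> v \<and> (v, u) \<in> parcs G)"
    using pair_finite_verts by (auto dest: in_arcsD1 in_arcsD2 no_loops' arcs_symmetric)
next
  assume A: "finite (pverts G) \<and> parcs G \<subseteq> pverts G \<times> pverts G
     \<and> (\<forall>u v. (u, v) \<in> parcs G \<longrightarrow> u \<noteq> v \<and> (v, u) \<in> parcs G)"
  then have "finite (parcs G)"
    by (meson finite_SigmaI finite_subset)
  with A show "pair_graph G"
    by unfold_locales (auto simp: symmetric_def intro!: symI)
qed

lemma pair_graph_path_graph: "pair_graph (path_graph n)"
  by (auto simp: pair_graph_iff path_graph_def)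

lemma pair_graph_complete_graph: "pair_graph (complete_graph n)"
  by (auto simp: pair_graph_iff complete_graph_def)

lemma pair_graph_complement_graph: "pair_graph G \<Longrightarrow> pair_graph (complement_graph G)"
  by (auto simp: pair_graph_iff complement_graph_def)

lemma pair_graph_disjoint_union_graph:
  "pair_graph G \<Longrightarrow> pair_graph H \<Longrightarrow> pair_graph (disjoint_union_graph G H)"
  by (fastforce simp: pair_graph_iff disjoint_union_graph_def)

lemma pair_graph_join_graph:
  "pair_graph G \<Longrightarrow> pair_graph H \<Longrightarrow> pair_graph (join_graph G H)"
  by (fastforce simp: pair_graph_iff join_graph_def disjoint_union_graph_def)

end

theory Submission
  imports Defs
begin

text \<open>
  Deleting \<open>N[D]\<close> leaves no edge exactly if every edge has an end in \<open>N[D]\<close>. Isolating sets and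
  ve-dominating sets are therefore the same sets (\<open>isolating_eq_ve_dominating\<close>), and everything
  reduces to ve-domination.

  Each forbidden graph has a vertex that ve-dominates all edges, and also two vertices that do so
  jointly but not singly: the ends of \<open>P\<^sub>4\<close>, one vertex from each \<open>K\<^sub>2\<close> of the butterfly
  \<open>K\<^sub>1 \<or> 2K\<^sub>2\<close>, and the two middle vertices of the paths in the complement of \<open>P\<^sub>3 \<union> P\<^sub>3\<close>.
  It has thus minimal ve-dominating sets of the sizes 1 and 2, so that no perfectly
  well-ve-dominated graph can contain it.

  Conversely, let \<open>G\<close> contain none of them. The key fact is that a minimal ve-dominating set has at
  most one vertex in each component (\<open>minimal_ve_dominating_reachable_eq\<close>). By minimality every
  vertex of the set has a private edge, one that no other vertex of the set ve-dominates. For two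
  vertices \<open>v\<close>, \<open>w\<close> in one component, \<open>P\<^sub>4\<close>-freeness gives distance at most 2. Their private edges
  then complete \<open>v\<close>, \<open>w\<close> to a complement of \<open>P\<^sub>3 \<union> P\<^sub>3\<close> if \<open>v\<close> and \<open>w\<close> are adjacent, and to a butterfly
  centred at a common neighbour otherwise (\<open>no_two_private_edges\<close>). A minimal ve-dominating set
  contains a vertex of each component that has an edge, and no other vertices, so its size is the
  number of these components. In particular it is 1 if \<open>G\<close> is connected and has an edge. Being free
  of the three graphs passes to induced subgraphs, which gives the equivalence.
\<close>

section \<open>Domination through adjacency\<close>

context wf_digraph
begin

lemma ve_dominating_iff:
  "ve_dominating G D \<longleftrightarrow> D \<subseteq> verts G \<and>
     (\<forall>a b. a \<rightarrow>\<^bsub>G\<^esub> b \<longrightarrow> a \<in> closed_nbhd_set G D \<or> b \<in> closed_nbhd_set G D)"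
  unfolding ve_dominating_def ve_dominates_def closed_nbhd_set_def arcs_ends_conv
  by fastforce

lemma isolating_eq_ve_dominating: "isolating G = ve_dominating G"
proof
  fix D
  have "arcs (G \<restriction> (verts G - closed_nbhd_set G D))
      = {e \<in> arcs G. tail G e \<notin> closed_nbhd_set G D \<and> head G e \<notin> closed_nbhd_set G D}"
    by auto
  then show "isolating G D = ve_dominating G D"
    unfolding isolating_def ve_dominating_def ve_dominates_def closed_nbhd_set_def by blast
qed

lemma ve_dominating_mono:
  "ve_dominating G D \<Longrightarrow> D \<subseteq> E \<Longrightarrow> E \<subseteq> verts G \<Longrightarrow> ve_dominating G E"
  unfolding ve_dominating_iff closed_nbhd_set_def by blast

lemma ve_dominating_verts: "ve_dominating G (verts G)"
  by (auto simp: ve_dominating_iff closed_nbhd_set_def closed_nbhd_def dest: adj_in_verts)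

text \<open>Domination is monotone, so that any proper subset which dominates can be enlarged to one
  that misses a single element.\<close>

lemma minimal_ve_dominating_iff:
  "minimal_set (ve_dominating G) D \<longleftrightarrow>
     ve_dominating G D \<and> (\<forall>v\<in>D. \<not> ve_dominating G (D - {v}))"
proof -
  have "\<not> ve_dominating G D'"
    if sub: "D' \<subset> D" and min: "\<forall>v\<in>D. \<not> ve_dominating G (D - {v})" and D: "ve_dominating G D" for D'
  proof -
    from sub obtain v where v: "v \<in> D" "v \<notin> D'"
      by blast
    then have "D' \<subseteq> D - {v}"
      using sub by blast
    moreover have "D - {v} \<subseteq> verts G"
      using D by (auto simp: ve_dominating_iff)
    ultimately show ?thesis
      using min v(1) ve_dominating_mono by blast
  qed
  then show ?thesis
    unfolding minimal_set_def by blast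
qed

text \<open>
  Under these hypotheses the empty set does not dominate, by monotonicity; so \<open>{u}\<close> and \<open>{x, y}\<close>
  are both minimal.
\<close>

lemma not_well_ve_dominatedI:
  assumes "ve_dominating G {u}" "ve_dominating G {x, y}"
    and "\<not> ve_dominating G {x}" "\<not> ve_dominating G {y}"
  shows "\<not> well_ve_dominated G"
proof -
  have "x \<noteq> y"
    using assms(2,3) by force
  moreover have "x \<in> verts G"
    using assms(2) by (simp add: ve_dominating_iff)
  ultimately have xy: "x \<noteq> y" "x \<in> verts G" .
  then have "\<not> ve_dominating G {}"
    using assms(3) ve_dominating_mono[of "{}" "{x}"] by auto
  then have "minimal_set (ve_dominating G) {u}" "minimal_set (ve_dominating G) {x, y}"
    using assms xy by (auto simp: minimal_ve_dominating_iff insert_Diff_if)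
  moreover have "card {u} \<noteq> card {x, y}"
    using xy by simp
  ultimately show ?thesis
    unfolding well_ve_dominated_def by blast
qed

end

text \<open>
  Removing \<open>v\<close> from a minimal set leaves some edge undominated. Since edges can be traversed in both
  directions, its end in the closed neighbourhood of \<open>v\<close> may be taken as the tail \<open>a\<close>.
\<close>

lemma (in sym_digraph) minimal_ve_dominating_private_edge:
  assumes "minimal_set (ve_dominating G) D" "v \<in> D"
  obtains a b where "a \<rightarrow>\<^bsub>G\<^esub> b" "a \<in> closed_nbhd G v"
    and "\<And>w. w \<in> D \<Longrightarrow> w \<noteq> v \<Longrightarrow> a \<notin> closed_nbhd G w \<and> b \<notin> closed_nbhd G w"
proof -
  have "ve_dominating G D" "\<not> ve_dominating G (D - {v})"
    using assms by (auto simp: minimal_ve_dominating_iff)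
  then obtain a b where "a \<rightarrow>\<^bsub>G\<^esub> b"
    and out: "a \<notin> closed_nbhd_set G (D - {v})" "b \<notin> closed_nbhd_set G (D - {v})"
    and "a \<in> closed_nbhd_set G D \<or> b \<in> closed_nbhd_set G D"
    unfolding ve_dominating_iff by blast
  moreover from this have "a \<in> closed_nbhd G v \<or> b \<in> closed_nbhd G v"
    unfolding closed_nbhd_set_def by blast
  moreover have "c \<notin> closed_nbhd G w"
    if "w \<in> D" "w \<noteq> v" "c \<notin> closed_nbhd_set G (D - {v})" for c w
    using that unfolding closed_nbhd_set_def by blast
  ultimately show thesis
    using that[of a b] that[of b a] graph_symmetric by metis
qed

section \<open>Induced subgraphs and isomorphism\<close>

lemma induced_subgraph_trans:
  assumes "induced_subgraph K H" "induced_subgraph H G"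
  shows "induced_subgraph K G"
proof -
  have "tail H = tail G" "head H = head G"
    using assms(2) by (auto simp: induced_subgraph_def subgraph_def compatible_def)
  then show ?thesis
    using assms subgraph_trans[of K H G]
    by (auto simp: induced_subgraph_def subgraph_def)
qed

lemma induced_free_induced_subgraph:
  "induced_free F G \<Longrightarrow> induced_subgraph H G \<Longrightarrow> induced_free F H"
  unfolding induced_free_def using induced_subgraph_trans by blast

lemma graph_induced_subgraph:
  assumes "graph G" "induced_subgraph H G"
  shows "graph H"
proof -
  interpret graph G by fact
  interpret H: digraph H by (rule digraphI_induced) fact
  interpret H: sym_digraph H by (rule induced_graph_imp_graph) fact
  show ?thesis by unfold_locales
qed

lemma (in wf_digraph) adj_app_iso_iff:
  assumes "digraph_isomorphism f" "u \<in> verts G" "v \<in> verts G"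
  shows "iso_verts f u \<rightarrow>\<^bsub>app_iso f G\<^esub> iso_verts f v \<longleftrightarrow> u \<rightarrow>\<^bsub>G\<^esub> v"
proof -
  have "arcs_ends (app_iso f G) = map_prod (iso_verts f) (iso_verts f) ` arcs_ends G"
    by (simp add: arcs_ends_conv image_image iso_verts_tail[OF assms(1)]
        iso_verts_head[OF assms(1)] cong: image_cong_simp)
  moreover have "u = a \<and> v = b"
    if "a \<rightarrow>\<^bsub>G\<^esub> b" "iso_verts f u = iso_verts f a" "iso_verts f v = iso_verts f b" for a b
    using that assms adj_in_verts[OF that(1)] by simp
  ultimately show ?thesis
    by auto
qed

lemma (in wf_digraph) ve_dominating_app_iso:
  assumes f: "digraph_isomorphism f" and D: "D \<subseteq> verts G"
  shows "ve_dominating (app_iso f G) (iso_verts f ` D) \<longleftrightarrow> ve_dominating G D"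
proof -
  interpret H: wf_digraph "app_iso f G"
    using f ..
  have adj: "iso_verts f u \<rightarrow>\<^bsub>app_iso f G\<^esub> iso_verts f v \<longleftrightarrow> u \<rightarrow>\<^bsub>G\<^esub> v"
    if "u \<in> verts G" "v \<in> verts G" for u v
    using f that by (rule adj_app_iso_iff)
  have nb: "iso_verts f u \<in> closed_nbhd_set (app_iso f G) (iso_verts f ` D)
      \<longleftrightarrow> u \<in> closed_nbhd_set G D" if "u \<in> verts G" for u
    using D f that adj iso_verts_eq_iff[OF f]
    unfolding closed_nbhd_set_def closed_nbhd_def by (auto simp: subset_iff)
  show ?thesis
  proof
    assume "ve_dominating (app_iso f G) (iso_verts f ` D)"
    then show "ve_dominating G D"
      unfolding ve_dominating_iff H.ve_dominating_iff using D adj nb adj_in_verts by metis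
  next
    assume dom: "ve_dominating G D"
    have "x \<in> closed_nbhd_set (app_iso f G) (iso_verts f ` D) \<or>
        y \<in> closed_nbhd_set (app_iso f G) (iso_verts f ` D)" if xy: "x \<rightarrow>\<^bsub>app_iso f G\<^esub> y" for x y
    proof -
      obtain a b where "a \<in> verts G" "b \<in> verts G" "x = iso_verts f a" "y = iso_verts f b"
        using H.adj_in_verts[OF xy] by auto
      then show ?thesis
        using dom xy adj nb unfolding ve_dominating_iff by metis
    qed
    then show "ve_dominating (app_iso f G) (iso_verts f ` D)"
      unfolding H.ve_dominating_iff using D by auto
  qed
qed

lemma well_ve_dominated_iso:
  assumes "wf_digraph H" "digraph_iso H F" "well_ve_dominated F"
  shows "well_ve_dominated H"
proof -
  interpret wf_digraph H by fact
  obtain f where f: "digraph_isomorphism f" and F: "F = app_iso f H"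
    using assms(2) unfolding digraph_iso_def by blast
  have inj: "inj_on (iso_verts f) (verts H)"
    using f by (rule digraph_isomorphism_inj_on_verts)
  have min: "minimal_set (ve_dominating F) (iso_verts f ` D)" and card: "card (iso_verts f ` D) = card D"
    if D: "minimal_set (ve_dominating H) D" for D
  proof -
    have sub: "D \<subseteq> verts H"
      using D by (auto simp: minimal_set_def ve_dominating_iff)
    then have injD: "inj_on (iso_verts f) D"
      using inj inj_on_subset by blast
    then show "card (iso_verts f ` D) = card D"
      by (rule card_image)
    have "\<not> ve_dominating F D'" if D': "D' \<subset> iso_verts f ` D" for D'
    proof -
      obtain D0 where D0: "D0 \<subseteq> D" "D' = iso_verts f ` D0"
        using D' by (meson psubset_imp_subset subset_imageE)
      with D' have "D0 \<subset> D" by blast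
      then show ?thesis
        using D D0 sub ve_dominating_app_iso[OF f, of D0]
        by (auto simp: minimal_set_def F)
    qed
    then show "minimal_set (ve_dominating F) (iso_verts f ` D)"
      using D sub ve_dominating_app_iso[OF f, of D] by (auto simp: minimal_set_def F)
  qed
  show ?thesis
    using assms(3) min card unfolding well_ve_dominated_def by metis
qed

lemma digraph_iso_sym:
  assumes "digraph_iso G H"
  shows "digraph_iso H G"
proof -
  obtain f where f: "pre_digraph.digraph_isomorphism G f" "H = app_iso f G"
    using assms unfolding digraph_iso_def by blast
  then interpret wf_digraph G
    by (simp add: pre_digraph.digraph_isomorphism_def)
  show ?thesis
    using f digraph_isomorphism_invI app_iso_inv unfolding digraph_iso_def by metis
qed

lemma perfectly_well_ve_dominated_imp_induced_free:
  assumes "perfectly_well_ve_dominated G" "wf_digraph F" "\<not> well_ve_dominated F"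
  shows "induced_free F G"
  using assms well_ve_dominated_iso digraph_iso_sym
  unfolding perfectly_well_ve_dominated_def induced_free_def by blast

text \<open>
  An isomorphism must also map the arcs bijectively. Without parallel arcs, the map that sends an
  arc to its pair of ends does so, whence an injection of the vertices that preserves and reflects
  adjacency is enough to exhibit an induced copy.
\<close>

lemma (in nomulti_digraph) not_induced_freeI:
  assumes F: "pair_wf_digraph F"
    and g: "inj_on g (pverts F)" "g ` pverts F \<subseteq> verts G"
    and adj: "\<forall>x\<in>pverts F. \<forall>y\<in>pverts F. g x \<rightarrow>\<^bsub>G\<^esub> g y \<longleftrightarrow> (x, y) \<in> parcs F"
  shows "\<not> induced_free (with_proj F) G"
proof -
  interpret F: pair_wf_digraph F by fact
  define H where "H = G \<restriction> (g ` pverts F)"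
  define h where "h = the_inv_into (pverts F) g"
  define f where "f = \<lparr>iso_verts = h, iso_arcs = (\<lambda>e. (h (tail G e), h (head G e))),
    iso_head = snd, iso_tail = fst\<rparr>"
  have h: "h (g x) = x" if "x \<in> pverts F" for x
    using that g(1) by (simp add: h_def the_inv_into_f_f)
  have ind: "induced_subgraph H G"
    unfolding H_def using g(2) by (rule induced_induce)
  have arcH: "\<exists>x\<in>pverts F. \<exists>y\<in>pverts F. tail G e = g x \<and> head G e = g y \<and> (x, y) \<in> parcs F"
    if "e \<in> arcs H" for e
  proof -
    obtain x y where xy: "x \<in> pverts F" "y \<in> pverts F" "tail G e = g x" "head G e = g y" "e \<in> arcs G"
      using \<open>e \<in> arcs H\<close> unfolding H_def by auto
    then have "g x \<rightarrow>\<^bsub>G\<^esub> g y"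
      by (auto intro: dominatesI simp: arc_to_ends_def)
    with xy show ?thesis using adj by blast
  qed
  have "inj_on (iso_arcs f) (arcs H)"
  proof (rule inj_onI)
    fix e e' assume e: "e \<in> arcs H" "e' \<in> arcs H" "iso_arcs f e = iso_arcs f e'"
    then have "tail G e = tail G e'" "head G e = head G e'"
      using arcH[OF e(1)] arcH[OF e(2)] by (auto simp: f_def h)
    then show "e = e'"
      using e by (intro no_multi_arcs) (auto simp: H_def arc_to_ends_def)
  qed
  moreover have "inj_on (iso_verts f) (verts H)"
    by (rule inj_onI) (auto simp: f_def H_def h)
  ultimately have "pre_digraph.digraph_isomorphism H f"
    unfolding pre_digraph.digraph_isomorphism_def H_def by (auto simp: f_def)
  moreover have "with_proj F = app_iso f H"
  proof (rule pre_digraph.equality)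
    show "verts (with_proj F) = verts (app_iso f H)"
      by (auto simp: f_def H_def h image_image)
    have "p \<in> iso_arcs f ` arcs H" if p: "p \<in> parcs F" for p
    proof -
      obtain x y where xy: "p = (x, y)" "x \<in> pverts F" "y \<in> pverts F"
        using p F.in_arcsD1 F.in_arcsD2 by (metis prod.exhaust)
      with p have "g x \<rightarrow>\<^bsub>G\<^esub> g y"
        using adj by blast
      then obtain e where "e \<in> arcs G" "tail G e = g x" "head G e = g y"
        by (rule reachableE)
      with xy show ?thesis
        by (intro image_eqI[of _ _ e]) (auto simp: f_def H_def h)
    qed
    moreover have "iso_arcs f ` arcs H \<subseteq> parcs F"
      using arcH by (fastforce simp: f_def h)
    ultimately show "arcs (with_proj F) = arcs (app_iso f H)"
      by auto
  qed (auto simp: f_def)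
  ultimately show ?thesis
    using ind unfolding induced_free_def digraph_iso_def by blast
qed

section \<open>The three forbidden graphs\<close>

definition butterfly :: "(nat + nat + nat) pair_pre_digraph" where
  "butterfly = join_graph (complete_graph 1)
     (disjoint_union_graph (complete_graph 2) (complete_graph 2))"

definition co_2P3 :: "(nat + nat) pair_pre_digraph" where
  "co_2P3 = complement_graph (disjoint_union_graph (path_graph 3) (path_graph 3))"

lemma pair_graph_butterfly: "pair_graph butterfly"
  unfolding butterfly_def
  by (intro pair_graph_join_graph pair_graph_disjoint_union_graph pair_graph_complete_graph)

lemma pair_graph_co_2P3: "pair_graph co_2P3"
  unfolding co_2P3_def
  by (intro pair_graph_complement_graph pair_graph_disjoint_union_graph pair_graph_path_graph)

text \<open>
  Adjacency in the three graphs is computed from membership rules instead of explicit arc sets: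
  with these rules the simplifier decides every statement that quantifies over the vertices only.
\<close>

lemma in_pverts_disjoint_union_graph:
  "Inl x \<in> pverts (disjoint_union_graph G H) \<longleftrightarrow> x \<in> pverts G"
  "Inr y \<in> pverts (disjoint_union_graph G H) \<longleftrightarrow> y \<in> pverts H"
  by (auto simp: disjoint_union_graph_def)

lemma in_parcs_disjoint_union_graph:
  "(Inl x, Inl x') \<in> parcs (disjoint_union_graph G H) \<longleftrightarrow> (x, x') \<in> parcs G"
  "(Inr y, Inr y') \<in> parcs (disjoint_union_graph G H) \<longleftrightarrow> (y, y') \<in> parcs H"
  "(Inl x, Inr y) \<notin> parcs (disjoint_union_graph G H)"
  "(Inr y, Inl x) \<notin> parcs (disjoint_union_graph G H)"
  by (auto simp: disjoint_union_graph_def)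

lemma in_parcs_join_graph:
  "(Inl x, Inl x') \<in> parcs (join_graph G H) \<longleftrightarrow> (x, x') \<in> parcs G"
  "(Inr y, Inr y') \<in> parcs (join_graph G H) \<longleftrightarrow> (y, y') \<in> parcs H"
  "(Inl x, Inr y) \<in> parcs (join_graph G H) \<longleftrightarrow> x \<in> pverts G \<and> y \<in> pverts H"
  "(Inr y, Inl x) \<in> parcs (join_graph G H) \<longleftrightarrow> x \<in> pverts G \<and> y \<in> pverts H"
  by (auto simp: join_graph_def in_parcs_disjoint_union_graph)

lemma in_parcs_complement_graph:
  "(u, v) \<in> parcs (complement_graph G) \<longleftrightarrow>
     u \<in> pverts G \<and> v \<in> pverts G \<and> u \<noteq> v \<and> (u, v) \<notin> parcs G"
  by (simp add: complement_graph_def)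

lemma in_complete_graph:
  "i \<in> pverts (complete_graph n) \<longleftrightarrow> i < n"
  "(i, j) \<in> parcs (complete_graph n) \<longleftrightarrow> i < n \<and> j < n \<and> i \<noteq> j"
  by (simp_all add: complete_graph_def)

lemma in_path_graph:
  "i \<in> pverts (path_graph n) \<longleftrightarrow> i < n"
  "(i, j) \<in> parcs (path_graph n) \<longleftrightarrow> i < n \<and> j < n \<and> (j = Suc i \<or> i = Suc j)"
  by (simp_all add: path_graph_def)

lemma lessThan_upto_4:
  "{..<1::nat} = {0}" "{..<2::nat} = {0, 1}" "{..<3::nat} = {0, 1, 2}" "{..<4::nat} = {0, 1, 2, 3}"
  by auto

lemma pverts_path_4: "pverts (path_graph 4) = {0, 1, 2, 3}"
  by (simp add: path_graph_def lessThan_upto_4)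

lemma pverts_butterfly:
  "pverts butterfly = {Inl 0, Inr (Inl 0), Inr (Inl 1), Inr (Inr 0), Inr (Inr 1)}"
  by (auto simp: butterfly_def join_graph_def disjoint_union_graph_def complete_graph_def
      lessThan_Suc lessThan_upto_4)

lemma pverts_co_2P3: "pverts co_2P3 = {Inl 0, Inl 1, Inl 2, Inr 0, Inr 1, Inr 2}"
  by (auto simp: co_2P3_def complement_graph_def disjoint_union_graph_def path_graph_def
      lessThan_upto_4)

lemmas in_parcs_butterfly =
  in_parcs_join_graph[where G = "complete_graph 1"
    and H = "disjoint_union_graph (complete_graph 2) (complete_graph 2)", folded butterfly_def]
  in_pverts_disjoint_union_graph
  in_parcs_disjoint_union_graph in_complete_graph

lemmas in_parcs_co_2P3 =
  in_parcs_complement_graph[where G = "disjoint_union_graph (path_graph 3) (path_graph 3)",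
    folded co_2P3_def]
  in_pverts_disjoint_union_graph
  in_parcs_disjoint_union_graph in_path_graph

lemma wf_digraph_with_proj: "pair_graph F \<Longrightarrow> wf_digraph (with_proj F)"
  by (auto simp: pair_graph_iff wf_digraph_def)

lemma ve_dominating_with_proj:
  assumes "pair_graph F"
  shows "ve_dominating (with_proj F) D \<longleftrightarrow> D \<subseteq> pverts F \<and>
    (\<forall>a\<in>pverts F. \<forall>b\<in>pverts F. (a, b) \<in> parcs F \<longrightarrow>
       (\<exists>v\<in>D. a = v \<or> b = v \<or> (v, a) \<in> parcs F \<or> (v, b) \<in> parcs F))"
proof -
  have "parcs F \<subseteq> pverts F \<times> pverts F"
    using assms by (simp add: pair_graph_iff)
  then show ?thesis
    unfolding ve_dominating_def ve_dominates_def closed_nbhd_def by fastforce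
qed

lemma not_well_ve_dominated_path_4: "\<not> well_ve_dominated (with_proj (path_graph 4))"
proof -
  interpret wf_digraph "with_proj (path_graph 4)"
    by (rule wf_digraph_with_proj) (rule pair_graph_path_graph)
  show ?thesis
    by (rule not_well_ve_dominatedI[of 1 0 3])
      (simp_all add: ve_dominating_with_proj pair_graph_path_graph pverts_path_4 in_path_graph)
qed

lemma not_well_ve_dominated_butterfly: "\<not> well_ve_dominated (with_proj butterfly)"
proof -
  interpret wf_digraph "with_proj butterfly"
    by (rule wf_digraph_with_proj) (rule pair_graph_butterfly)
  show ?thesis
    by (rule not_well_ve_dominatedI[of "Inl 0" "Inr (Inl 0)" "Inr (Inr 0)"])
      (simp_all add: ve_dominating_with_proj pair_graph_butterfly pverts_butterfly in_parcs_butterfly)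
qed

lemma not_well_ve_dominated_co_2P3: "\<not> well_ve_dominated (with_proj co_2P3)"
proof -
  interpret wf_digraph "with_proj co_2P3"
    by (rule wf_digraph_with_proj) (rule pair_graph_co_2P3)
  show ?thesis
    by (rule not_well_ve_dominatedI[of "Inl 0" "Inl 1" "Inr 1"])
      (simp_all add: ve_dominating_with_proj pair_graph_co_2P3 pverts_co_2P3 in_parcs_co_2P3)
qed

section \<open>Graphs without the three forbidden graphs\<close>

locale forbidden_free_graph = graph G for G (structure) +
  assumes P4_free: "induced_free (with_proj (path_graph 4)) G"
    and butterfly_free: "induced_free (with_proj butterfly) G"
    and co_2P3_free: "induced_free (with_proj co_2P3) G"
begin

text \<open>
  The next three facts express the absence of each graph by adjacencies alone. Degenerate
  configurations are covered as well: if two of the vertices coincide, the given adjacencies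
  contradict the absence of loops or already provide one of the listed chords.
\<close>

lemma P4_chord:
  assumes "a \<rightarrow> b" "b \<rightarrow> c" "c \<rightarrow> d"
  shows "a \<rightarrow> c \<or> a \<rightarrow> d \<or> b \<rightarrow> d"
proof (rule ccontr)
  assume no: "\<not> ?thesis"
  interpret F: pair_graph "path_graph 4" by (rule pair_graph_path_graph)
  have adj: "b \<rightarrow> a" "c \<rightarrow> b" "d \<rightarrow> c" "\<not> c \<rightarrow> a" "\<not> d \<rightarrow> a" "\<not> d \<rightarrow> b" "\<And>x. \<not> x \<rightarrow> x"
    using assms no graph_symmetric adj_not_same by blast+
  then have "distinct [a, b, c, d]"
    using assms no by auto
  then have "\<not> induced_free (with_proj (path_graph 4)) G"
    using assms no adj
    by (intro not_induced_freeI[where g = "(!) [a, b, c, d]"])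
      (simp_all add: pverts_path_4 in_path_graph adj_in_verts F.pair_wf_digraph_axioms)
  with P4_free show False by blast
qed

lemma butterfly_chord:
  assumes "u \<rightarrow> v" "u \<rightarrow> a" "v \<rightarrow> a" "u \<rightarrow> w" "u \<rightarrow> c" "w \<rightarrow> c"
  shows "v \<rightarrow> w \<or> v \<rightarrow> c \<or> a \<rightarrow> w \<or> a \<rightarrow> c"
proof (rule ccontr)
  assume no: "\<not> ?thesis"
  interpret F: pair_graph butterfly by (rule pair_graph_butterfly)
  have adj: "v \<rightarrow> u" "a \<rightarrow> u" "a \<rightarrow> v" "w \<rightarrow> u" "c \<rightarrow> u" "c \<rightarrow> w"
    "\<not> w \<rightarrow> v" "\<not> c \<rightarrow> v" "\<not> w \<rightarrow> a" "\<not> c \<rightarrow> a" "\<And>x. \<not> x \<rightarrow> x"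
    using assms no graph_symmetric adj_not_same by blast+
  then have "distinct [u, v, a, w, c]"
    using assms no by auto
  then have "\<not> induced_free (with_proj butterfly) G"
    using assms no adj
    by (intro not_induced_freeI[where g = "case_sum (\<lambda>_. u) (case_sum ((!) [v, a]) ((!) [w, c]))"])
      (simp_all add: pverts_butterfly in_parcs_butterfly adj_in_verts F.pair_wf_digraph_axioms)
  with butterfly_free show False by blast
qed

lemma co_2P3_chord:
  assumes "v \<rightarrow> w" "v \<rightarrow> a" "v \<rightarrow> b" "a \<rightarrow> b" "w \<rightarrow> c" "w \<rightarrow> d" "c \<rightarrow> d"
    and "a \<rightarrow> c" "a \<rightarrow> d" "b \<rightarrow> c" "b \<rightarrow> d"
  shows "v \<rightarrow> c \<or> v \<rightarrow> d \<or> w \<rightarrow> a \<or> w \<rightarrow> b"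
proof (rule ccontr)
  assume no: "\<not> ?thesis"
  interpret F: pair_graph co_2P3 by (rule pair_graph_co_2P3)
  have adj: "w \<rightarrow> v" "a \<rightarrow> v" "b \<rightarrow> v" "b \<rightarrow> a" "c \<rightarrow> w" "d \<rightarrow> w" "d \<rightarrow> c"
    "c \<rightarrow> a" "d \<rightarrow> a" "c \<rightarrow> b" "d \<rightarrow> b"
    "\<not> c \<rightarrow> v" "\<not> d \<rightarrow> v" "\<not> a \<rightarrow> w" "\<not> b \<rightarrow> w" "\<And>x. \<not> x \<rightarrow> x"
    using assms no graph_symmetric adj_not_same by blast+
  then have "distinct [c, v, d, a, w, b]"
    using assms no by auto
  then have "\<not> induced_free (with_proj co_2P3) G"
    using assms no adj
    \<comment> \<open>The middle vertices \<open>v\<close>, \<open>w\<close> of the two paths are their index 1: in \<open>G\<close> each path shows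
      its missing edges, so its ends are adjacent and its middle vertex is isolated from them.\<close>
    by (intro not_induced_freeI[where g = "case_sum ((!) [c, v, d]) ((!) [a, w, b])"])
      (simp_all add: pverts_co_2P3 in_parcs_co_2P3 adj_in_verts F.pair_wf_digraph_axioms)
  with co_2P3_free show False by blast
qed

text \<open>A walk of length 3 has a chord, which shortens it to length at most 2.\<close>

lemma reachable_distance_le_2:
  assumes "v \<rightarrow>\<^sup>* w"
  shows "v = w \<or> v \<rightarrow> w \<or> (\<exists>u. v \<rightarrow> u \<and> u \<rightarrow> w)"
  using assms
proof (induction rule: reachable_induct)
  case base
  then show ?case by simp
next
  case (step x y)
  then show ?case using P4_chord by blast
qed

text \<open>
  The heart of the proof; \<open>ab\<close> and \<open>cd\<close> play the role of private edges of \<open>v\<close> and \<open>w\<close>.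

  If \<open>v\<close> and \<open>w\<close> are adjacent, then \<open>P\<^sub>4\<close>-freeness makes \<open>vab\<close> and \<open>wcd\<close> triangles and joins \<open>{a, b}\<close>
  completely to \<open>{c, d}\<close>. The only missing edges are those from \<open>v\<close> to \<open>c\<close>, \<open>d\<close> and from \<open>w\<close> to
  \<open>a\<close>, \<open>b\<close>, which form two disjoint paths on three vertices.

  Otherwise they have a common neighbour \<open>u\<close>, and each private edge contains a vertex that forms a
  triangle with \<open>u\<close> and its owner. There is no edge between the two triangles apart from those at
  \<open>u\<close>, so they form a butterfly.
\<close>

lemma no_two_private_edges:
  assumes reach: "v \<rightarrow>\<^sup>* w" and "v \<noteq> w"
    and ab: "a \<rightarrow> b" "a \<in> closed_nbhd G v" "a \<notin> closed_nbhd G w" "b \<notin> closed_nbhd G w"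
    and cd: "c \<rightarrow> d" "c \<in> closed_nbhd G w" "c \<notin> closed_nbhd G v" "d \<notin> closed_nbhd G v"
  shows False
proof (cases "v \<rightarrow> w")
  case True
  note sym = graph_symmetric
  have va: "v \<rightarrow> a" and wc: "w \<rightarrow> c"
    using True ab cd sym by (auto simp: closed_nbhd_def)
  have non: "\<not> w \<rightarrow> a" "\<not> w \<rightarrow> b" "\<not> v \<rightarrow> c" "\<not> v \<rightarrow> d"
    using ab cd by (auto simp: closed_nbhd_def)
  have "v \<rightarrow> b"
    using P4_chord[of b a v w] ab va True non sym by blast
  moreover have "w \<rightarrow> d"
    using P4_chord[of d c w v] cd wc True non sym by blast
  moreover have "x \<rightarrow> y" if "v \<rightarrow> x" "w \<rightarrow> y" "\<not> w \<rightarrow> x" "\<not> v \<rightarrow> y" for x y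
    using P4_chord[of x v w y] that True sym by blast
  ultimately show False
    using co_2P3_chord[of v w a b c d] True va wc non ab cd by blast
next
  case False
  note sym = graph_symmetric
  obtain u where u: "u \<rightarrow> v" "u \<rightarrow> w"
    using reachable_distance_le_2[OF reach] \<open>v \<noteq> w\<close> False sym by blast
  \<comment> \<open>Stated for an owner \<open>s\<close> of the edge \<open>pq\<close> and the other vertex \<open>t\<close>, to serve both sides. If \<open>s\<close>
    is itself the end \<open>p\<close>, the third vertex of the triangle has to be \<open>q\<close>.\<close>
  have triangle: "\<exists>x\<in>{p, q}. x \<rightarrow> s \<and> u \<rightarrow> x"
    if "p \<rightarrow> q" "p \<in> closed_nbhd G s" "p \<notin> closed_nbhd G t" "q \<notin> closed_nbhd G t"
      "u \<rightarrow> s" "u \<rightarrow> t" "\<not> s \<rightarrow> t" for p q s t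
  proof -
    have non: "\<not> t \<rightarrow> p" "\<not> t \<rightarrow> q"
      using that by (auto simp: closed_nbhd_def)
    show ?thesis
    proof (cases "p = s")
      case True
      then show ?thesis
        using P4_chord[of t u s q] that non sym by blast
    next
      case False
      then have "s \<rightarrow> p"
        using that by (auto simp: closed_nbhd_def)
      then show ?thesis
        using P4_chord[of t u s p] that non sym by blast
    qed
  qed
  obtain x where x: "x \<in> {a, b}" "x \<rightarrow> v" "u \<rightarrow> x"
    using triangle[OF ab] u False by blast
  obtain y where y: "y \<in> {c, d}" "y \<rightarrow> w" "u \<rightarrow> y"
    using triangle[OF cd] u False sym by blast
  have non: "\<not> w \<rightarrow> x" "\<not> v \<rightarrow> y"
    using x(1) y(1) ab cd by (auto simp: closed_nbhd_def)
  have "\<not> x \<rightarrow> y"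
    using P4_chord[of v x y w] x y non False sym by blast
  then show False
    using butterfly_chord[of u v x w y] u x y non False sym by blast
qed

lemma minimal_ve_dominating_reachable_eq:
  assumes D: "minimal_set (ve_dominating G) D" and vw: "v \<in> D" "w \<in> D" "v \<rightarrow>\<^sup>* w"
  shows "v = w"
proof (rule ccontr)
  assume "v \<noteq> w"
  obtain a b where "a \<rightarrow> b" "a \<in> closed_nbhd G v" "a \<notin> closed_nbhd G w" "b \<notin> closed_nbhd G w"
    using minimal_ve_dominating_private_edge[OF D vw(1)] vw(2) \<open>v \<noteq> w\<close> by metis
  moreover obtain c d where
    "c \<rightarrow> d" "c \<in> closed_nbhd G w" "c \<notin> closed_nbhd G v" "d \<notin> closed_nbhd G v"
    using minimal_ve_dominating_private_edge[OF D vw(2)] vw(1) \<open>v \<noteq> w\<close> by metis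
  ultimately show False
    using no_two_private_edges[OF vw(3) \<open>v \<noteq> w\<close>] by blast
qed

text \<open>
  The private edge of \<open>v \<in> D\<close> is ve-dominated by a vertex of \<open>D'\<close> in the same component as \<open>v\<close>.
  Choosing one such vertex for each \<open>v\<close> is injective, for \<open>D\<close> has at most one vertex per component.
  This compares the sizes without reference to the number of components.
\<close>

lemma card_minimal_le_card_minimal:
  assumes D: "minimal_set (ve_dominating G) D" and D': "minimal_set (ve_dominating G) D'"
  shows "card D \<le> card D'"
proof -
  have sub: "D' \<subseteq> verts G" "D \<subseteq> verts G"
    using D D' by (auto simp: minimal_set_def ve_dominating_iff)
  have nb: "v \<rightarrow>\<^sup>* x" if "v \<in> verts G" "x \<in> closed_nbhd G v" for v x
    using that by (auto simp: closed_nbhd_def)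
  have "\<exists>v'\<in>D'. v \<rightarrow>\<^sup>* v'" if v: "v \<in> D" for v
  proof -
    obtain a b where ab: "a \<rightarrow> b" "a \<in> closed_nbhd G v"
      using minimal_ve_dominating_private_edge[OF D v] by blast
    then obtain v' x where v': "v' \<in> D'" "x \<in> {a, b}" "x \<in> closed_nbhd G v'"
      using D' unfolding minimal_set_def ve_dominating_iff closed_nbhd_set_def by blast
    have "v \<rightarrow>\<^sup>* x"
      using nb[of v a] ab v'(2) sub v by (auto intro: reachable_adj_trans)
    moreover have "x \<rightarrow>\<^sup>* v'"
      using nb[of v' x] v' sub symmetric_reachable[OF sym_arcs] by blast
    ultimately show ?thesis
      using v'(1) reachable_trans by blast
  qed
  then obtain f where f: "\<And>v. v \<in> D \<Longrightarrow> f v \<in> D' \<and> v \<rightarrow>\<^sup>* f v"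
    by metis
  have "inj_on f D"
  proof (rule inj_onI)
    fix v w assume vw: "v \<in> D" "w \<in> D" "f v = f w"
    then have "v \<rightarrow>\<^sup>* w"
      using f[of v] f[of w] symmetric_reachable[OF sym_arcs] reachable_trans by metis
    then show "v = w"
      using D vw minimal_ve_dominating_reachable_eq by blast
  qed
  moreover have "finite D'"
    using sub(1) finite_verts by (rule finite_subset)
  ultimately show ?thesis
    using f by (intro card_inj_on_le[of f]) auto
qed

lemma well_ve_dominated: "well_ve_dominated G"
  unfolding well_ve_dominated_def using card_minimal_le_card_minimal le_antisym by blast

lemma ve_domination_number_connected:
  assumes "connected G" "card (verts G) \<ge> 2"
  shows "\<gamma>\<^sub>v\<^sub>e G = 1"
proof -
  have reach: "u \<rightarrow>\<^sup>* v" if "u \<in> verts G" "v \<in> verts G" for u v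
    using assms(1) that reachable_mk_symmetric_eq[OF sym_arcs]
    unfolding connected_def strongly_connected_def by simp
  have fin: "finite {D. ve_dominating G D}"
    by (rule finite_subset[of _ "Pow (verts G)"]) (auto simp: ve_dominating_iff)
  have fin_sub: "finite D" if "ve_dominating G D" for D
    using that finite_verts finite_subset unfolding ve_dominating_iff by blast
  obtain p q where "p \<in> verts G" "q \<in> verts G" "p \<noteq> q"
    using assms(2) card_le_Suc0_iff_eq[OF finite_verts] by (auto simp: not_less_eq_eq numeral_2_eq_2)
  then obtain r where "p \<rightarrow> r"
    using reach[of p q] converse_reachable_cases by metis
  then have ne: "\<not> ve_dominating G {}"
    by (auto simp: ve_dominating_iff closed_nbhd_set_def)
  \<comment> \<open>A smallest ve-dominating set is minimal, hence has at most one vertex in the only component.\<close>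
  obtain D where D: "ve_dominating G D" "\<And>E. ve_dominating G E \<Longrightarrow> card D \<le> card E"
    using ve_dominating_verts ex_has_least_nat[of "ve_dominating G" _ card] by blast
  have "minimal_set (ve_dominating G) D"
    using D fin_sub psubset_card_mono leD unfolding minimal_set_def by metis
  then have "v = w" if "v \<in> D" "w \<in> D" for v w
    using minimal_ve_dominating_reachable_eq reach that D(1)
    unfolding ve_dominating_iff by blast
  then have "card D \<le> 1"
    using card_le_Suc0_iff_eq[OF fin_sub[OF D(1)]] by auto
  moreover have "card D \<noteq> 0"
    using D(1) ne fin_sub by auto
  ultimately have "card D = 1" by simp
  then have "Min (card ` {D. ve_dominating G D}) = 1"
    using D fin by (intro Min_eqI) (auto intro: image_eqI[of _ _ D])
  then show ?thesis
    by (simp add: ve_domination_number_def)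
qed

end

lemma forbidden_free_graph_iff:
  "forbidden_free_graph G \<longleftrightarrow> graph G \<and> induced_free (with_proj (path_graph 4)) G \<and>
     induced_free (with_proj butterfly) G \<and> induced_free (with_proj co_2P3) G"
  by (auto simp: forbidden_free_graph_def forbidden_free_graph_axioms_def)

lemma perfectly_well_ve_dominated_iff_forbidden_free:
  assumes "graph G"
  shows "perfectly_well_ve_dominated G \<longleftrightarrow> forbidden_free_graph G"
proof
  assume "perfectly_well_ve_dominated G"
  then show "forbidden_free_graph G"
    using assms wf_digraph_with_proj pair_graph_path_graph pair_graph_butterfly pair_graph_co_2P3
      not_well_ve_dominated_path_4 not_well_ve_dominated_butterfly not_well_ve_dominated_co_2P3
      perfectly_well_ve_dominated_imp_induced_free
    unfolding forbidden_free_graph_iff by metis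
next
  assume "forbidden_free_graph G"
  then have "forbidden_free_graph H" if "induced_subgraph H G" for H
    using that graph_induced_subgraph induced_free_induced_subgraph
    unfolding forbidden_free_graph_iff by metis
  then show "perfectly_well_ve_dominated G"
    unfolding perfectly_well_ve_dominated_def
    using forbidden_free_graph.well_ve_dominated by blast
qed

theorem theorem9:
  fixes G :: "('a, 'b) pre_digraph"
  assumes "graph G"
  shows "(perfectly_well_ve_dominated G \<longleftrightarrow> perfectly_well_isolated G) \<and>
    (perfectly_well_ve_dominated G \<longleftrightarrow>
      induced_free (with_proj (path_graph 4)) G \<and>
      induced_free (with_proj (join_graph (complete_graph 1)
        (disjoint_union_graph (complete_graph 2) (complete_graph 2)))) G \<and>
      induced_free (with_proj (complement_graph
        (disjoint_union_graph (path_graph 3) (path_graph 3)))) G) \<and>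
    (connected G \<and> card (verts G) \<ge> 2 \<and> perfectly_well_ve_dominated G \<longrightarrow>
      \<gamma>\<^sub>v\<^sub>e G = 1 \<and> \<iota> G = 1)"
proof -
  interpret graph G by fact
  have "well_ve_dominated H \<longleftrightarrow> well_isolated H" if "induced_subgraph H G" for H
    using wf_digraph.isolating_eq_ve_dominating[OF wf_digraphI_induced[OF that]]
    by (simp add: well_ve_dominated_def well_isolated_def)
  then have "perfectly_well_ve_dominated G \<longleftrightarrow> perfectly_well_isolated G"
    by (simp add: perfectly_well_ve_dominated_def perfectly_well_isolated_def)
  moreover have "\<iota> G = \<gamma>\<^sub>v\<^sub>e G"
    by (simp add: isolation_number_def ve_domination_number_def isolating_eq_ve_dominating)
  ultimately show ?thesis
    using assms perfectly_well_ve_dominated_iff_forbidden_free[OF assms]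
      forbidden_free_graph.ve_domination_number_connected[of G]
    unfolding forbidden_free_graph_iff butterfly_def co_2P3_def by metis
qed

end
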